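(* Let $\mathcal G$ be a simple (possibly directed) graph on $\mathcal V=\{1,\dots,m\}$ with adjacency matrix $[a_{ij}]$, real weights $w_{ij}$ (not required to be positive) and a clustering $\mathcal C=\{\mathcal C_1,\dots,\mathcal C_K\}$. Define $G=[g_{ij}]_{i,j=1}^m$ by $g_{ij}=w_{ij}$ if $i\neq j$ and $a_{ij}=1$, $g_{ij}=0$ if $i\ne j$ and $a_{ij}=0$, and $g_{ii}=-\sum_{k\ne i}g_{ik}$. Let $f_1,\dots,f_K:\mathbb R^n\to\mathbb R^n$ be continuous, $\Gamma\in\mathbb R^{n\times n}$, and consider the coupled system $$\dot x^i=f_k(x^i)+\sum_{j=1}^m g_{ij}\Gamma x^j,\qquad i\in\mathcal C_k,\ k=1,\dots,K.$$ Suppose that the common inter-cluster coupling condition $$\sum_{j\in\mathcal N_{k'}(i)}w_{ij}=\sum_{j'\in\mathcal N_{k'}(i')}w_{i'j'}\qquad\text{for all } i,i'\in\mathcal C_k \text{ and all } k\neq k'$$ is satisfied, that, for some $\alpha\in\mathbb R$, each $f_k(\cdot)-\alpha\Gamma\,\cdot$ $(k=1,\dots,K)$ satisfies the decreasing condition, and that $\Gamma$ is symmetric and nonnegative definite. If there exists a positive definite diagonal matrix $D=\mathrm{diag}[d_1,\dots,d_m]$, with $d=[d_1,\dots,d_m]^\top$, such that $$\big[D(G+\alpha I_m)\big]^{s}\big|_{\mathcal T^{d}_{\mathcal C}(1)}\le 0,$$ then the coupled system cluster synchronizes with respect to the clustering $\mathcal C$, i.e. for every solution, $\lim_{t\to\infty}[x^i(t)-x^j(t)]=0$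 for all $i,j\in\mathcal C_k$ and all $k=1,\dots,K$.
   Context: Graph and clustering: "simple" means no self-loops or multiple edges. $a_{ij}=1$ if there is an edge from vertex $j$ to vertex $i$, and $a_{ij}=0$ otherwise; $\mathcal N(i)=\{j:a_{ij}=1\}$. A clustering is a partition of $\mathcal V$: $\bigcup_{k=1}^K\mathcal C_k=\mathcal V$ and $\mathcal C_k\cap\mathcal C_l=\emptyset$ for $k\neq l$. $\mathcal N_{k}(i)=\mathcal N(i)\cap\mathcal C_{k}$; empty sums are $0$. Decreasing condition for $f_k(\cdot)-\alpha\Gamma\,\cdot$: there exists $\delta>0$ such that $(\xi-\zeta)^\top[f_k(\xi)-f_k(\zeta)-\alpha\Gamma(\xi-\zeta)]\le-\delta(\xi-\zeta)^\top(\xi-\zeta)$ for all $\xi,\zeta\in\mathbb R^n$. Transverse space: $\mathcal T^d_{\mathcal C}(1)=\{u=[u^1,\dots,u^m]^\top\in\mathbb R^m:\ \sum_{i\in\mathcal C_k}d_iu^i=0\ \text{for all }k=1,\dots,K\}$. Matrix notation: $Z^s=(Z+Z^\top)/2$, $I_m$ is the identity matrix, and $Z|_V\le 0$ means $u^\top Zu\le 0$ for all $u$ in the linear subspace $V$. Standing assumptions: solutions of the coupled system exist for all $t\ge0$ and are bounded. The $x^i(t)\in\mathbb R^n$ are the vertex states. The functions $f_k$ of different clusters are assumed so different that trajectories in different clusters do not approach each other; under this assumption cluster synchronization means the convergence stated in the claim. *)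

theory Defs
  imports "HOL-Analysis.Analysis" "HOL-Library.Disjoint_Sets" "Graph_Theory.Pair_Digraph"
begin

(* The arc (j, i) runs from j to i, so row i of the adjacency matrix lists the in-neighbours of i. *)
definition adj :: "'m::finite pair_pre_digraph \<Rightarrow> real ^ 'm ^ 'm" where
  "adj \<G> = (\<chi> i j. if (j, i) \<in> parcs \<G> then 1 else 0)"

definition nbrs :: "'m::finite pair_pre_digraph \<Rightarrow> 'm \<Rightarrow> 'm set" where
  "nbrs \<G> i = {j. adj \<G> $ i $ j = 1}"

(* Clusters are indexed by a finite type and are not required to be nonempty. *)
definition clustering :: "('k \<Rightarrow> 'm set) \<Rightarrow> bool" where
  "clustering C \<longleftrightarrow> (\<Union>k. C k) = UNIV \<and> disjoint_family C"

definition common_intercluster_coupling ::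
  "'m::finite pair_pre_digraph \<Rightarrow> ('m \<Rightarrow> 'm \<Rightarrow> real) \<Rightarrow> ('k \<Rightarrow> 'm set) \<Rightarrow> bool" where
  "common_intercluster_coupling \<G> w C \<longleftrightarrow>
     (\<forall>k k'. k \<noteq> k' \<longrightarrow> (\<forall>i\<in>C k. \<forall>i'\<in>C k.
        (\<Sum>j\<in>nbrs \<G> i \<inter> C k'. w i j) = (\<Sum>j'\<in>nbrs \<G> i' \<inter> C k'. w i' j')))"

definition off_diag_entry ::
  "'m::finite pair_pre_digraph \<Rightarrow> ('m \<Rightarrow> 'm \<Rightarrow> real) \<Rightarrow> 'm \<Rightarrow> 'm \<Rightarrow> real" where
  "off_diag_entry \<G> w i j = (if adj \<G> $ i $ j = 1 then w i j else 0)"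

definition coupling_matrix ::
  "'m::finite pair_pre_digraph \<Rightarrow> ('m \<Rightarrow> 'm \<Rightarrow> real) \<Rightarrow> real ^ 'm ^ 'm" where
  "coupling_matrix \<G> w =
     (\<chi> i j. if i \<noteq> j then off_diag_entry \<G> w i j
             else - (\<Sum>k\<in>UNIV - {i}. off_diag_entry \<G> w i k))"

(* x t $ i is the state of vertex i at time t; at t = 0 the derivative is one-sided. *)
definition coupled_solution ::
  "('k \<Rightarrow> 'm::finite set) \<Rightarrow> ('k \<Rightarrow> real ^ 'n \<Rightarrow> real ^ 'n) \<Rightarrow> real ^ 'm ^ 'm \<Rightarrow>
   real ^ 'n::finite ^ 'n \<Rightarrow> (real \<Rightarrow> real ^ 'n ^ 'm) \<Rightarrow> bool" where
  "coupled_solution C f G \<Gamma> x \<longleftrightarrow>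
     (\<forall>k. \<forall>i\<in>C k. \<forall>t\<ge>0.
        ((\<lambda>s. x s $ i) has_vector_derivative
           f k (x t $ i) + (\<Sum>j\<in>UNIV. (G $ i $ j) *\<^sub>R (\<Gamma> *v (x t $ j)))) (at t within {0..}))"

definition solutions_global_bounded ::
  "('k \<Rightarrow> 'm::finite set) \<Rightarrow> ('k \<Rightarrow> real ^ 'n \<Rightarrow> real ^ 'n) \<Rightarrow> real ^ 'm ^ 'm \<Rightarrow>
   real ^ 'n::finite ^ 'n \<Rightarrow> bool" where
  "solutions_global_bounded C f G \<Gamma> \<longleftrightarrow>
     (\<forall>x0. \<exists>x. coupled_solution C f G \<Gamma> x \<and> x 0 = x0) \<and>
     (\<forall>x. coupled_solution C f G \<Gamma> x \<longrightarrow> bounded (x ` {0..}))"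

definition cluster_synchronizes ::
  "('k \<Rightarrow> 'm::finite set) \<Rightarrow> ('k \<Rightarrow> real ^ 'n \<Rightarrow> real ^ 'n) \<Rightarrow> real ^ 'm ^ 'm \<Rightarrow>
   real ^ 'n::finite ^ 'n \<Rightarrow> bool" where
  "cluster_synchronizes C f G \<Gamma> \<longleftrightarrow>
     (\<forall>x. coupled_solution C f G \<Gamma> x \<longrightarrow>
        (\<forall>k. \<forall>i\<in>C k. \<forall>j\<in>C k. ((\<lambda>t. x t $ i - x t $ j) \<longlongrightarrow> 0) at_top))"

definition decreasing_condition ::
  "(real ^ 'n \<Rightarrow> real ^ 'n) \<Rightarrow> real \<Rightarrow> real ^ 'n::finite ^ 'n \<Rightarrow> bool" where
  "decreasing_condition f \<alpha> \<Gamma> \<longleftrightarrow>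
     (\<exists>\<delta>>0. \<forall>\<xi> \<zeta>. (\<xi> - \<zeta>) \<bullet> (f \<xi> - f \<zeta> - \<alpha> *\<^sub>R (\<Gamma> *v (\<xi> - \<zeta>)))
                    \<le> - \<delta> * ((\<xi> - \<zeta>) \<bullet> (\<xi> - \<zeta>)))"

definition symmetric_matrix :: "real ^ 'n ^ 'n \<Rightarrow> bool" where
  "symmetric_matrix Z \<longleftrightarrow> transpose Z = Z"

definition nonneg_definite :: "real ^ 'n::finite ^ 'n \<Rightarrow> bool" where
  "nonneg_definite Z \<longleftrightarrow> (\<forall>u. u \<bullet> (Z *v u) \<ge> 0)"

definition pos_definite :: "real ^ 'n::finite ^ 'n \<Rightarrow> bool" where
  "pos_definite Z \<longleftrightarrow> (\<forall>u. u \<noteq> 0 \<longrightarrow> u \<bullet> (Z *v u) > 0)"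

definition diag :: "real ^ 'm \<Rightarrow> real ^ 'm ^ 'm" where
  "diag d = (\<chi> i j. if i = j then d $ i else 0)"

definition sym_part :: "real ^ 'm ^ 'm \<Rightarrow> real ^ 'm::finite ^ 'm" where
  "sym_part Z = (1 / 2) *\<^sub>R (Z + transpose Z)"

definition nonpos_on :: "real ^ 'm::finite ^ 'm \<Rightarrow> (real ^ 'm) set \<Rightarrow> bool" where
  "nonpos_on Z V \<longleftrightarrow> (\<forall>u\<in>V. u \<bullet> (Z *v u) \<le> 0)"

definition transverse_space :: "('k \<Rightarrow> 'm::finite set) \<Rightarrow> real ^ 'm \<Rightarrow> (real ^ 'm) set" where
  "transverse_space C d = {u. \<forall>k. (\<Sum>i\<in>C k. d $ i * u $ i) = 0}"

end

theory Submission
  imports Defs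
begin

text \<open>
  The proof is a Lyapunov argument. Give vertex \<open>i\<close> the mass \<open>d\<^sub>i\<close>, let \<open>z\<^sub>k\<close> be the centre of mass
  of the states in cluster \<open>C\<^sub>k\<close>, and let \<open>e\<^sub>i = x\<^sub>i - z\<^sub>k\<close> for \<open>i \<in> C\<^sub>k\<close>. By the choice of the
  centre, \<open>\<Sum>\<^sub>i d\<^sub>i e\<^sub>i = 0\<close> over every cluster. Hence in the derivative of
  \<open>V = \<Sum>\<^sub>i d\<^sub>i \<bar>e\<^sub>i\<bar>\<^sup>2\<close> every term \<open>\<Sum>\<^sub>i d\<^sub>i e\<^sub>i \<bullet> b\<close> whose vector \<open>b\<close> depends only on the cluster
  of \<open>i\<close> disappears (\<open>deviation_orthogonal\<close>). Three terms are of this kind: the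
  velocity of the centre; the value \<open>f\<^sub>k(z\<^sub>k)\<close>, which can therefore be subtracted from \<open>f\<^sub>k(x\<^sub>i)\<close>; and the
  force that the centres of all clusters exert on \<open>i\<close>. The last one is common to the vertices of a
  cluster because the row sums of \<open>G\<close> over each block are: off the diagonal blocks this is the common
  inter-cluster coupling condition, and on the diagonal blocks it follows since all rows of \<open>G\<close> sum
  to zero (\<open>coupling_matrix_block_row_sums\<close>).

  What remains of half the derivative of \<open>V\<close> is a sum of two parts. The first,
  \<open>\<Sum>\<^sub>i d\<^sub>i e\<^sub>i \<bullet> (f\<^sub>k(x\<^sub>i) - f\<^sub>k(z\<^sub>k) - \<alpha> \<Gamma> e\<^sub>i)\<close>, is at most \<open>- \<delta> V\<close> by the decreasing condition.
  The second is the quadratic form of \<open>Z \<otimes> \<Gamma>\<close> with \<open>Z = D (G + \<alpha> I)\<close> at the family \<open>e\<close>. Writing the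
  positive semidefinite form of \<open>\<Gamma>\<close> as a sum of squares of linear functionals \<open>\<phi>\<close>
  (\<open>psd_form_sum_of_squares\<close>) turns it into a sum of values \<open>u\<^sup>T Z u\<close> with \<open>u\<^sub>i = \<phi>(e\<^sub>i)\<close>, and every such
  \<open>u\<close> lies in the transverse space, so this part is nonpositive (\<open>transverse_family_nonpos\<close>). Thus
  \<open>V' \<le> - 2 \<delta> V\<close>, so \<open>V\<close> decays exponentially and all deviations tend to zero.
\<close>

section \<open>Positive semidefinite forms as sums of squares\<close>

lemma psd_form_null_vector:
  fixes B :: "'a::real_vector \<Rightarrow> 'a \<Rightarrow> real"
  assumes lin: "\<And>x. linear (B x)" and sym: "\<And>x y. B x y = B y x"
    and psd: "\<And>x. B x x \<ge> 0" and null: "B a a = 0"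
  shows "B a y = 0"
proof (rule ccontr)
  assume neq: "B a y \<noteq> 0"
  \<comment> \<open>On the line \<open>y + s a\<close> the form is affine in \<open>s\<close>; this \<open>s\<close> gives it the value \<open>-1\<close>.\<close>
  define s where "s = - (B y y + 1) / (2 * B a y)"
  have "0 \<le> B (y + s *\<^sub>R a) (y + s *\<^sub>R a)" by (rule psd)
  also have "\<dots> = B y y + 2 * s * B a y"
    using null sym[of y a]
    by (simp add: linear_add[OF lin] linear_scale[OF lin] sym[of "y + s *\<^sub>R a"])
  also have "\<dots> = - 1" using neq by (simp add: s_def field_simps)
  finally show False by simp
qed

text \<open>
  This is symmetric Gaussian elimination (the Cholesky decomposition without a choice of coordinates):
  subtracting the square of \<open>B a x / sqrt (B a a)\<close> leaves a positive semidefinite form that has \<open>a\<close> in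
  its radical. Stating the hypothesis as \<open>A\<close> spanning the space together with the radical of \<open>B\<close> lets
  the induction remove one vector of \<open>A\<close> per step, since the radical only grows.
\<close>

lemma psd_form_sum_of_squares:
  fixes B :: "'a::real_vector \<Rightarrow> 'a \<Rightarrow> real"
  assumes "finite A"
    and "\<And>x. linear (B x)" and "\<And>x y. B x y = B y x" and "\<And>x. B x x \<ge> 0"
    and "span (A \<union> {x. \<forall>y. B x y = 0}) = UNIV"
  shows "\<exists>\<phi>. (\<forall>a. linear (\<phi> a)) \<and> (\<forall>x y. B x y = (\<Sum>a\<in>A. \<phi> a x * \<phi> a y))"
  using assms
proof (induction A arbitrary: B rule: finite_induct)
  case empty
  have "subspace {x. \<forall>y. B y x = 0}"
    by (simp add: subspace_def linear_0[OF empty.prems(1)]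
        linear_add[OF empty.prems(1)] linear_scale[OF empty.prems(1)])
  then have "subspace {x. \<forall>y. B x y = 0}"
    using empty.prems(2) by simp
  then have "{x. \<forall>y. B x y = 0} = UNIV"
    using empty.prems(4) by (metis span_eq_iff sup_bot_left)
  then have "B x y = 0" for x y by blast
  then show ?case by (intro exI[of _ "\<lambda>_ _. 0"]) (simp add: linear_zero)
next
  case (insert a A)
  note lin = insert.prems(1) and sym = insert.prems(2) and psd = insert.prems(3)
  define q where "q = B a a"
  \<comment> \<open>If \<open>q = 0\<close>, then \<open>a\<close> is in the radical already, and division by zero makes \<open>B'\<close> equal to \<open>B\<close>.\<close>
  define B' where "B' x y = B x y - B a x * B a y / q" for x y
  have lin': "linear (B' x)" for x
    unfolding B'_def
    by (rule linearI) (simp_all add: linear_add[OF lin] linear_scale[OF lin] algebra_simps add_divide_distrib)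
  have sym': "B' x y = B' y x" for x y
    by (simp add: B'_def sym[of x y])
  have null: "B a y = 0" if "q = 0" for y
    using psd_form_null_vector[of B, OF lin sym psd] that by (simp add: q_def)
  have psd': "B' x x \<ge> 0" for x
  proof -
    \<comment> \<open>\<open>B' x x\<close> is the value of \<open>B\<close> at the component of \<open>x\<close> that is \<open>B\<close>-orthogonal to \<open>a\<close>.\<close>
    define s where "s = B a x / q"
    have "0 \<le> B (x - s *\<^sub>R a) (x - s *\<^sub>R a)" by (rule psd)
    also have "\<dots> = B x x - 2 * s * B a x + s * s * q"
      using sym[of x a]
      by (simp add: linear_diff[OF lin] linear_scale[OF lin] sym[of "x - s *\<^sub>R a"] q_def algebra_simps)
    also have "\<dots> = B' x x" by (cases "q = 0") (simp_all add: s_def B'_def)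
    finally show ?thesis .
  qed
  have "insert a A \<union> {x. \<forall>y. B x y = 0} \<subseteq> A \<union> {x. \<forall>y. B' x y = 0}"
  proof -
    have "B' a y = 0" for y using null by (cases "q = 0") (simp_all add: B'_def q_def[symmetric])
    moreover have "B' x y = 0" if "\<forall>y. B x y = 0" for x y
      using that sym[of a x] by (simp add: B'_def)
    ultimately show ?thesis by blast
  qed
  then have "span (A \<union> {x. \<forall>y. B' x y = 0}) = UNIV"
    using insert.prems(4) span_mono by blast
  from insert.IH[of B', OF lin' sym' psd' this] obtain \<phi> where
    \<phi>: "\<And>b. linear (\<phi> b)" "\<And>x y. B' x y = (\<Sum>b\<in>A. \<phi> b x * \<phi> b y)"
    by blast
  define \<psi> where "\<psi> = \<phi>(a := (\<lambda>x. B a x / sqrt q))"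
  have "q \<ge> 0" using psd by (simp add: q_def)
  have "linear (\<lambda>x. B a x / sqrt q)"
    by (rule linearI) (simp_all add: linear_add[OF lin] linear_scale[OF lin] add_divide_distrib)
  then have "\<forall>b. linear (\<psi> b)" using \<phi>(1) by (simp add: \<psi>_def)
  moreover have "B x y = (\<Sum>b\<in>insert a A. \<psi> b x * \<psi> b y)" for x y
  proof -
    have "(\<Sum>b\<in>A. \<psi> b x * \<psi> b y) = B' x y"
      unfolding \<phi>(2) using insert.hyps by (intro sum.cong) (auto simp: \<psi>_def)
    moreover have "\<psi> a x * \<psi> a y = B a x * B a y / q"
      using \<open>q \<ge> 0\<close> by (simp add: \<psi>_def)
    ultimately show ?thesis using insert.hyps by (simp add: B'_def)
  qed
  ultimately show ?case by blast
qed

lemma inner_sym_part_mult: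
  fixes u :: "real ^ 'm::finite"
  shows "u \<bullet> (sym_part Z *v u) = u \<bullet> (Z *v u)"
proof -
  have "u \<bullet> (transpose Z *v u) = u \<bullet> (Z *v u)"
    by (metis dot_lmul_matrix inner_commute transpose_matrix_vector)
  moreover have "sym_part Z *v u = (1/2) *\<^sub>R (Z *v u + transpose Z *v u)"
    by (simp add: sym_part_def scaleR_matrix_vector_assoc[symmetric] matrix_vector_mult_add_rdistrib)
  ultimately show ?thesis by (simp add: inner_add_right)
qed

text \<open>
  Decompose the form of \<open>\<Gamma>\<close> into squares of linear functionals. Each of them maps the family \<open>e\<close>, by
  linearity, to a vector of the transverse space, where the hypothesis on \<open>Z\<close> applies.
\<close>

lemma transverse_family_nonpos:
  fixes \<Gamma> :: "real ^ 'n::finite ^ 'n" and Z :: "real ^ 'm::finite ^ 'm"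
    and e :: "'m \<Rightarrow> real ^ 'n"
  assumes "symmetric_matrix \<Gamma>" and "nonneg_definite \<Gamma>"
    and nonpos: "nonpos_on (sym_part Z) (transverse_space C d)"
    and trans: "\<And>k. (\<Sum>i\<in>C k. d $ i *\<^sub>R e i) = 0"
  shows "(\<Sum>i\<in>UNIV. \<Sum>j\<in>UNIV. Z $ i $ j * (e i \<bullet> (\<Gamma> *v e j))) \<le> 0"
proof -
  have "x \<bullet> (\<Gamma> *v y) = y \<bullet> (\<Gamma> *v x)" for x y
    using assms(1) unfolding symmetric_matrix_def
    by (metis dot_lmul_matrix inner_commute transpose_matrix_vector)
  moreover have "linear (\<lambda>y. x \<bullet> (\<Gamma> *v y))" for x
    by (rule linearI) (simp_all add: matrix_vector_right_distrib inner_add_right matrix_vector_mult_scaleR)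
  moreover have "x \<bullet> (\<Gamma> *v x) \<ge> 0" for x
    using assms(2) by (simp add: nonneg_definite_def)
  moreover have "span (Basis \<union> N) = UNIV" for N :: "(real ^ 'n) set"
    by (metis span_Basis span_mono sup_ge1 top.extremum_uniqueI)
  ultimately obtain \<phi> :: "real ^ 'n \<Rightarrow> real ^ 'n \<Rightarrow> real" where
    \<phi>: "\<And>b. linear (\<phi> b)" "\<And>x y. x \<bullet> (\<Gamma> *v y) = (\<Sum>b\<in>Basis. \<phi> b x * \<phi> b y)"
    using psd_form_sum_of_squares[of Basis "\<lambda>x y. x \<bullet> (\<Gamma> *v y)"] finite_Basis by metis
  define u where "u b = (\<chi> i. \<phi> b (e i))" for b
  have "u b \<in> transverse_space C d" for b
  proof -
    have "(\<Sum>i\<in>C k. d $ i * u b $ i) = \<phi> b (\<Sum>i\<in>C k. d $ i *\<^sub>R e i)" for k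
      by (simp add: u_def linear_sum[OF \<phi>(1)] linear_scale[OF \<phi>(1)])
    then show ?thesis by (simp add: transverse_space_def trans linear_0[OF \<phi>(1)])
  qed
  then have "u b \<bullet> (Z *v u b) \<le> 0" for b
    using nonpos by (simp add: nonpos_on_def inner_sym_part_mult)
  then have "(\<Sum>b\<in>Basis. u b \<bullet> (Z *v u b)) \<le> 0" by (simp add: sum_nonpos)
  moreover have "(\<Sum>b\<in>Basis. u b \<bullet> (Z *v u b)) =
      (\<Sum>b\<in>Basis. \<Sum>i\<in>UNIV. \<Sum>j\<in>UNIV. Z $ i $ j * (\<phi> b (e i) * \<phi> b (e j)))"
    by (simp add: u_def inner_vec_def matrix_vector_mult_def sum_distrib_left algebra_simps)
  moreover have "\<dots> = (\<Sum>i\<in>UNIV. \<Sum>j\<in>UNIV. \<Sum>b\<in>Basis. Z $ i $ j * (\<phi> b (e i) * \<phi> b (e j)))"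
    by (subst sum.swap, rule sum.cong[OF refl], rule sum.swap)
  ultimately show ?thesis by (simp add: \<phi>(2) sum_distrib_left)
qed

section \<open>Block row sums of the coupling matrix\<close>

definition cluster_of :: "('k \<Rightarrow> 'm set) \<Rightarrow> 'm \<Rightarrow> 'k" where
  "cluster_of C i = (THE k. i \<in> C k)"

lemma clustering_mem_iff:
  assumes "clustering C"
  shows "i \<in> C k \<longleftrightarrow> cluster_of C i = k"
proof -
  have uniq: "k' = k''" if "i \<in> C k'" "i \<in> C k''" for k' k''
    using assms that unfolding clustering_def disjoint_family_on_def by blast
  obtain l where l: "i \<in> C l" using assms unfolding clustering_def by blast
  then have "cluster_of C i = l"
    unfolding cluster_of_def using uniq by blast
  then show ?thesis using l uniq by blast
qed

lemma sum_over_clusters: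
  fixes C :: "'k::finite \<Rightarrow> 'm::finite set"
  assumes "clustering C"
  shows "(\<Sum>i\<in>UNIV. h i) = (\<Sum>k\<in>UNIV. \<Sum>i\<in>C k. h i)"
proof -
  have "(\<Sum>i\<in>\<Union>(range C). h i) = (\<Sum>k\<in>UNIV. \<Sum>i\<in>C k. h i)"
    using assms by (intro sum.UNION_disjoint) (auto simp: clustering_def disjoint_family_on_def)
  then show ?thesis using assms by (simp add: clustering_def)
qed

text \<open>
  Here \<open>l = k\<close> is included: the diagonal of \<open>G\<close> makes each full row sum zero, so the row sum over the
  diagonal block is minus the row sums over the other blocks, which the coupling condition controls.
\<close>

lemma coupling_matrix_block_row_sums:
  fixes C :: "'k::finite \<Rightarrow> 'm::finite set"
  assumes cl: "clustering C" and common: "common_intercluster_coupling \<G> w C"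
    and i: "i \<in> C k" "i' \<in> C k"
  shows "(\<Sum>j\<in>C l. coupling_matrix \<G> w $ i $ j) = (\<Sum>j\<in>C l. coupling_matrix \<G> w $ i' $ j)"
proof -
  let ?G = "coupling_matrix \<G> w"
  have off: "(\<Sum>j\<in>C l. ?G $ i $ j) = (\<Sum>j\<in>C l. ?G $ i' $ j)" if "l \<noteq> k" for l
  proof -
    have "(\<Sum>j\<in>C l. ?G $ i $ j) = (\<Sum>j\<in>nbrs \<G> i \<inter> C l. w i j)" if "i \<in> C k" for i
    proof -
      have "i \<noteq> j" if "j \<in> C l" for j
        using that \<open>i \<in> C k\<close> \<open>l \<noteq> k\<close> by (auto simp: clustering_mem_iff[OF cl])
      then have "(\<Sum>j\<in>C l. ?G $ i $ j) = (\<Sum>j\<in>C l. if adj \<G> $ i $ j = 1 then w i j else 0)"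
        by (intro sum.cong) (auto simp: coupling_matrix_def off_diag_entry_def)
      also have "\<dots> = (\<Sum>j\<in>nbrs \<G> i \<inter> C l. w i j)"
        by (intro sum.mono_neutral_cong_right) (auto simp: nbrs_def)
      finally show ?thesis .
    qed
    then show ?thesis using i that common unfolding common_intercluster_coupling_def by metis
  qed
  have row: "(\<Sum>j\<in>UNIV. ?G $ i $ j) = 0" for i
  proof -
    have "(\<Sum>j\<in>UNIV. ?G $ i $ j) = ?G $ i $ i + (\<Sum>j\<in>UNIV - {i}. ?G $ i $ j)"
      by (simp add: sum.remove)
    also have "(\<Sum>j\<in>UNIV - {i}. ?G $ i $ j) = (\<Sum>j\<in>UNIV - {i}. off_diag_entry \<G> w i j)"
      by (intro sum.cong) (auto simp: coupling_matrix_def)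
    finally show ?thesis by (simp add: coupling_matrix_def)
  qed
  have "(\<Sum>j\<in>C k. ?G $ i $ j) = - (\<Sum>l\<in>UNIV - {k}. \<Sum>j\<in>C l. ?G $ i $ j)" for i
    using row[of i] by (simp add: sum_over_clusters[OF cl] sum.remove[of UNIV k])
  moreover have "(\<Sum>l\<in>UNIV - {k}. \<Sum>j\<in>C l. ?G $ i $ j) = (\<Sum>l\<in>UNIV - {k}. \<Sum>j\<in>C l. ?G $ i' $ j)"
    by (intro sum.cong off) auto
  ultimately show ?thesis using off by (cases "l = k") auto
qed

section \<open>Deviations from the weighted cluster centres\<close>

definition centroid :: "real ^ 'm \<Rightarrow> 'm::finite set \<Rightarrow> real ^ 'n ^ 'm \<Rightarrow> real ^ 'n" where
  "centroid d S x = (1 / (\<Sum>i\<in>S. d $ i)) *\<^sub>R (\<Sum>i\<in>S. d $ i *\<^sub>R x $ i)"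

definition deviation :: "('k \<Rightarrow> 'm::finite set) \<Rightarrow> real ^ 'm \<Rightarrow> real ^ 'n ^ 'm \<Rightarrow> 'm \<Rightarrow> real ^ 'n" where
  "deviation C d x i = x $ i - centroid d (C (cluster_of C i)) x"

lemma sum_weighted_deviation:
  assumes cl: "clustering C" and pos: "\<And>i. d $ i > 0"
  shows "(\<Sum>i\<in>C k. d $ i *\<^sub>R deviation C d x i) = 0"
proof (cases "C k = {}")
  case False
  then have "(\<Sum>i\<in>C k. d $ i) > 0" by (intro sum_pos) (auto simp: pos)
  then have "(\<Sum>i\<in>C k. d $ i) *\<^sub>R centroid d (C k) x = (\<Sum>i\<in>C k. d $ i *\<^sub>R x $ i)"
    by (simp add: centroid_def)
  moreover have "(\<Sum>i\<in>C k. d $ i *\<^sub>R deviation C d x i)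
      = (\<Sum>i\<in>C k. d $ i *\<^sub>R x $ i - d $ i *\<^sub>R centroid d (C k) x)"
    by (intro sum.cong) (auto simp: deviation_def clustering_mem_iff[OF cl] scaleR_diff_right)
  ultimately show ?thesis by (simp add: sum_subtractf scaleR_left.sum)
qed simp

text \<open>
  In every cluster \<open>b\<close> factors out of the vanishing weighted sum of deviations. This is what
  allows adding to the dynamics any term that depends only on the cluster.
\<close>

lemma deviation_orthogonal:
  fixes C :: "'k::finite \<Rightarrow> 'm::finite set"
  assumes cl: "clustering C" and pos: "\<And>i. d $ i > 0"
  shows "(\<Sum>i\<in>UNIV. d $ i * (deviation C d x i \<bullet> b (cluster_of C i))) = 0"
proof -
  have "(\<Sum>i\<in>C k. d $ i * (deviation C d x i \<bullet> b (cluster_of C i))) = 0" for k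
  proof -
    have "(\<Sum>i\<in>C k. d $ i * (deviation C d x i \<bullet> b (cluster_of C i)))
        = (\<Sum>i\<in>C k. d $ i *\<^sub>R deviation C d x i) \<bullet> b k"
      by (auto simp: inner_sum_left clustering_mem_iff[OF cl] intro!: sum.cong)
    then show ?thesis by (simp add: sum_weighted_deviation[OF cl pos])
  qed
  then show ?thesis by (simp add: sum_over_clusters[OF cl])
qed

definition vertex_velocity ::
  "('k \<Rightarrow> 'm::finite set) \<Rightarrow> ('k \<Rightarrow> real ^ 'n \<Rightarrow> real ^ 'n) \<Rightarrow> real ^ 'm ^ 'm \<Rightarrow>
   real ^ 'n::finite ^ 'n \<Rightarrow> real ^ 'n ^ 'm \<Rightarrow> 'm \<Rightarrow> real ^ 'n" where
  "vertex_velocity C f G \<Gamma> x i =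
     f (cluster_of C i) (x $ i) + (\<Sum>j\<in>UNIV. (G $ i $ j) *\<^sub>R (\<Gamma> *v (x $ j)))"

section \<open>Dissipation and decay\<close>

text \<open>
  The left-hand side is half the derivative of \<open>\<Sum>\<^sub>i d\<^sub>i \<bar>e\<^sub>i\<bar>\<^sup>2\<close> along a solution, the velocity of the
  centres being invisible by orthogonality. The velocity of vertex \<open>i\<close> is split
  as \<open>p\<^sub>i + b\<^sub>k + (\<alpha> \<Gamma> e\<^sub>i + \<Sum>\<^sub>j g\<^sub>i\<^sub>j \<Gamma> e\<^sub>j)\<close>: the decreasing condition bounds the first summand, the
  second depends only on the cluster \<open>k\<close> of \<open>i\<close>, and the third yields the quadratic form of
  \<open>D (G + \<alpha> I)\<close> and \<open>\<Gamma>\<close>.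
\<close>

lemma deviation_dissipation:
  fixes C :: "'k::finite \<Rightarrow> 'm::finite set" and x :: "real ^ 'n::finite ^ 'm"
  assumes cl: "clustering C" and pos: "\<And>i. d $ i > 0"
    and block: "\<And>k l i i'. i \<in> C k \<Longrightarrow> i' \<in> C k \<Longrightarrow> (\<Sum>j\<in>C l. G $ i $ j) = (\<Sum>j\<in>C l. G $ i' $ j)"
    and decr: "\<And>k \<xi> \<zeta>. (\<xi> - \<zeta>) \<bullet> (f k \<xi> - f k \<zeta> - \<alpha> *\<^sub>R (\<Gamma> *v (\<xi> - \<zeta>)))
                    \<le> - \<delta> * ((\<xi> - \<zeta>) \<bullet> (\<xi> - \<zeta>))"
    and \<Gamma>: "symmetric_matrix \<Gamma>" "nonneg_definite \<Gamma>"
    and nonpos: "nonpos_on (sym_part (diag d ** (G + \<alpha> *\<^sub>R mat 1))) (transverse_space C d)"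
  shows "(\<Sum>i\<in>UNIV. d $ i * (deviation C d x i \<bullet> vertex_velocity C f G \<Gamma> x i))
    \<le> - \<delta> * (\<Sum>i\<in>UNIV. d $ i * (deviation C d x i \<bullet> deviation C d x i))"
proof -
  define e where "e = deviation C d x"
  define z where "z k = centroid d (C k) x" for k
  \<comment> \<open>Any vertex of cluster \<open>k\<close> represents the common row sum over block \<open>l\<close>.\<close>
  define r where "r k l = (\<Sum>j\<in>C l. G $ (SOME i. i \<in> C k) $ j)" for k l
  define b where "b k = f k (z k) + (\<Sum>l\<in>UNIV. r k l *\<^sub>R (\<Gamma> *v z l))" for k
  define p where "p i = f (cluster_of C i) (x $ i) - f (cluster_of C i) (z (cluster_of C i)) - \<alpha> *\<^sub>R (\<Gamma> *v e i)" for i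
  define Z where "Z = diag d ** (G + \<alpha> *\<^sub>R mat 1)"
  have x_eq: "x $ i = e i + z (cluster_of C i)" for i
    by (simp add: e_def z_def deviation_def)
  have r: "(\<Sum>j\<in>C l. G $ i $ j) = r (cluster_of C i) l" for i l
  proof -
    have "i \<in> C (cluster_of C i)" by (simp add: clustering_mem_iff[OF cl])
    then show ?thesis unfolding r_def by (intro block) (auto intro: someI)
  qed
  have coupling: "(\<Sum>j\<in>UNIV. (G $ i $ j) *\<^sub>R (\<Gamma> *v (x $ j)))
      = (\<Sum>j\<in>UNIV. (G $ i $ j) *\<^sub>R (\<Gamma> *v e j)) + (\<Sum>l\<in>UNIV. r (cluster_of C i) l *\<^sub>R (\<Gamma> *v z l))" for i
  proof -
    have "(\<Sum>j\<in>UNIV. (G $ i $ j) *\<^sub>R (\<Gamma> *v z (cluster_of C j)))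
        = (\<Sum>l\<in>UNIV. \<Sum>j\<in>C l. (G $ i $ j) *\<^sub>R (\<Gamma> *v z l))"
      unfolding sum_over_clusters[OF cl]
      by (intro sum.cong) (auto simp: clustering_mem_iff[OF cl])
    also have "\<dots> = (\<Sum>l\<in>UNIV. r (cluster_of C i) l *\<^sub>R (\<Gamma> *v z l))"
      by (simp add: scaleR_left.sum[symmetric] r)
    finally show ?thesis
      by (simp add: x_eq matrix_vector_right_distrib scaleR_add_right sum.distrib)
  qed
  have vel: "vertex_velocity C f G \<Gamma> x i = p i + b (cluster_of C i)
      + (\<alpha> *\<^sub>R (\<Gamma> *v e i) + (\<Sum>j\<in>UNIV. (G $ i $ j) *\<^sub>R (\<Gamma> *v e j)))" for i
    unfolding vertex_velocity_def coupling p_def b_def by simp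
  have Z_entry: "Z $ i $ j = d $ i * (G $ i $ j + (if i = j then \<alpha> else 0))" for i j
  proof -
    have "Z $ i $ j = (\<Sum>k\<in>UNIV. (if i = k then d $ i else 0) * (G + \<alpha> *\<^sub>R mat 1) $ k $ j)"
      by (simp add: Z_def matrix_matrix_mult_def diag_def)
    also have "\<dots> = (\<Sum>k\<in>UNIV. if i = k then d $ i * (G + \<alpha> *\<^sub>R mat 1) $ k $ j else 0)"
      by (intro sum.cong) auto
    finally have "Z $ i $ j = d $ i * (G + \<alpha> *\<^sub>R mat 1) $ i $ j" by simp
    then show ?thesis by (simp add: mat_def)
  qed
  have quad: "(\<Sum>i\<in>UNIV. d $ i * (e i \<bullet> (\<alpha> *\<^sub>R (\<Gamma> *v e i) + (\<Sum>j\<in>UNIV. (G $ i $ j) *\<^sub>R (\<Gamma> *v e j)))))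
      = (\<Sum>i\<in>UNIV. \<Sum>j\<in>UNIV. Z $ i $ j * (e i \<bullet> (\<Gamma> *v e j)))"
  proof (rule sum.cong[OF refl])
    fix i
    have "(\<Sum>j\<in>UNIV. Z $ i $ j * (e i \<bullet> (\<Gamma> *v e j)))
        = (\<Sum>j\<in>UNIV. d $ i * (G $ i $ j * (e i \<bullet> (\<Gamma> *v e j)))
            + (if i = j then d $ i * (\<alpha> * (e i \<bullet> (\<Gamma> *v e i))) else 0))"
      by (intro sum.cong) (auto simp: Z_entry algebra_simps)
    also have "\<dots> = d $ i * (\<Sum>j\<in>UNIV. G $ i $ j * (e i \<bullet> (\<Gamma> *v e j)))
        + d $ i * (\<alpha> * (e i \<bullet> (\<Gamma> *v e i)))"
      by (simp add: sum.distrib sum_distrib_left)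
    finally show "d $ i * (e i \<bullet> (\<alpha> *\<^sub>R (\<Gamma> *v e i) + (\<Sum>j\<in>UNIV. (G $ i $ j) *\<^sub>R (\<Gamma> *v e j))))
        = (\<Sum>j\<in>UNIV. Z $ i $ j * (e i \<bullet> (\<Gamma> *v e j)))"
      by (simp add: inner_add_right inner_sum_right algebra_simps)
  qed
  have "(\<Sum>i\<in>UNIV. d $ i * (e i \<bullet> vertex_velocity C f G \<Gamma> x i))
      = (\<Sum>i\<in>UNIV. d $ i * (e i \<bullet> p i)) + (\<Sum>i\<in>UNIV. d $ i * (e i \<bullet> b (cluster_of C i)))
        + (\<Sum>i\<in>UNIV. \<Sum>j\<in>UNIV. Z $ i $ j * (e i \<bullet> (\<Gamma> *v e j)))"
    unfolding vel quad[symmetric] by (simp only: inner_add_right distrib_left sum.distrib)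
  moreover have "(\<Sum>i\<in>UNIV. d $ i * (e i \<bullet> b (cluster_of C i))) = 0"
    unfolding e_def by (rule deviation_orthogonal[OF cl pos])
  moreover have "(\<Sum>i\<in>UNIV. \<Sum>j\<in>UNIV. Z $ i $ j * (e i \<bullet> (\<Gamma> *v e j))) \<le> 0"
    using nonpos \<Gamma> unfolding e_def Z_def
    by (intro transverse_family_nonpos[where C = C and d = d] sum_weighted_deviation[OF cl pos])
  moreover have "(\<Sum>i\<in>UNIV. d $ i * (e i \<bullet> p i)) \<le> (\<Sum>i\<in>UNIV. d $ i * (- \<delta> * (e i \<bullet> e i)))"
  proof (intro sum_mono mult_left_mono)
    fix i
    have "x $ i - z (cluster_of C i) = e i" by (simp add: x_eq)
    then show "e i \<bullet> p i \<le> - \<delta> * (e i \<bullet> e i)"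
      using decr[of "x $ i" "z (cluster_of C i)" "cluster_of C i"] by (simp add: p_def)
    show "0 \<le> d $ i" using pos[of i] by simp
  qed
  moreover have "(\<Sum>i\<in>UNIV. d $ i * (- \<delta> * (e i \<bullet> e i))) = - \<delta> * (\<Sum>i\<in>UNIV. d $ i * (e i \<bullet> e i))"
    unfolding sum_distrib_left by (simp add: algebra_simps)
  ultimately show ?thesis unfolding e_def by linarith
qed

text \<open>
  The differential form of Gronwall's inequality: \<open>V t * exp (a * t)\<close> has a nonpositive derivative.
\<close>

lemma exponential_decay:
  fixes V V' :: "real \<Rightarrow> real"
  assumes deriv: "\<And>t. t \<ge> 0 \<Longrightarrow> (V has_real_derivative V' t) (at t within {0..})"
    and le: "\<And>t. t \<ge> 0 \<Longrightarrow> V' t \<le> - a * V t" and t: "t \<ge> 0"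
  shows "V t \<le> V 0 * exp (- a * t)"
proof -
  define h where "h s = V s * exp (a * s)" for s
  have h: "(h has_real_derivative (V' s + a * V s) * exp (a * s)) (at s within {0..})" if "s \<ge> 0" for s
    unfolding h_def by (rule derivative_eq_intros deriv that refl | simp add: algebra_simps)+
  have "h t \<le> h 0"
  proof (rule DERIV_nonpos_imp_decreasing_open[OF t])
    fix s :: real assume "0 < s" "s < t"
    then have "at s within {0..} = at s" by (intro at_within_interior) (simp add: interior_Ici)
    then have "(h has_real_derivative (V' s + a * V s) * exp (a * s)) (at s)"
      using h[of s] \<open>0 < s\<close> by simp
    moreover have "(V' s + a * V s) * exp (a * s) \<le> 0"
      using le[of s] \<open>0 < s\<close> by (intro mult_nonpos_nonneg) auto
    ultimately show "\<exists>y. (h has_real_derivative y) (at s) \<and> y \<le> 0" by blast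
  next
    have "continuous_on {0..} h" using h by (intro DERIV_continuous_on) auto
    then show "continuous_on {0..t} h" by (rule continuous_on_subset) auto
  qed
  then show ?thesis by (simp add: h_def exp_minus field_simps)
qed

text \<open>The deviation is linear in the configuration, so it commutes with differentiation.\<close>

lemma has_vector_derivative_deviation:
  fixes x :: "real \<Rightarrow> real ^ 'n::finite ^ 'm::finite"
  assumes "\<And>i. ((\<lambda>s. x s $ i) has_vector_derivative y $ i) F"
  shows "((\<lambda>s. deviation C d (x s) i) has_vector_derivative deviation C d y i) F"
proof -
  have lin: "((\<lambda>s. c *\<^sub>R g s) has_vector_derivative c *\<^sub>R g') F"
    if "(g has_vector_derivative g') F" for c and g :: "real \<Rightarrow> real ^ 'n" and g'
    using bounded_linear.has_vector_derivative[OF bounded_linear_scaleR_right that] .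
  show ?thesis
    unfolding deviation_def centroid_def
    by (intro has_vector_derivative_diff lin has_vector_derivative_sum assms)
qed

theorem theorem4:
  fixes \<G> :: "'m::finite pair_pre_digraph"
    and w :: "'m \<Rightarrow> 'm \<Rightarrow> real"
    and C :: "'k::finite \<Rightarrow> 'm set"
    and f :: "'k \<Rightarrow> real ^ 'n::finite \<Rightarrow> real ^ 'n"
    and \<Gamma> :: "real ^ 'n ^ 'n"
    and \<alpha> :: real
  assumes "pair_digraph \<G>" and "pverts \<G> = UNIV"
    and "clustering C"
    and "\<And>k. continuous_on UNIV (f k)"
    and "solutions_global_bounded C f (coupling_matrix \<G> w) \<Gamma>"
    and "common_intercluster_coupling \<G> w C"
    and "\<And>k. decreasing_condition (f k) \<alpha> \<Gamma>"
    and "symmetric_matrix \<Gamma>" and "nonneg_definite \<Gamma>"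
    and "\<exists>d. pos_definite (diag d) \<and>
           nonpos_on (sym_part (diag d ** (coupling_matrix \<G> w + \<alpha> *\<^sub>R mat 1)))
             (transverse_space C d)"
  shows "cluster_synchronizes C f (coupling_matrix \<G> w) \<Gamma>"
proof -
  let ?G = "coupling_matrix \<G> w"
  note cl = assms(3)
  obtain d where d: "pos_definite (diag d)"
    and nonpos: "nonpos_on (sym_part (diag d ** (?G + \<alpha> *\<^sub>R mat 1))) (transverse_space C d)"
    using assms(10) by blast
  have pos: "d $ i > 0" for i
  proof -
    have "axis i 1 \<bullet> (diag d *v axis i 1) > 0"
      using d by (simp add: pos_definite_def)
    then show ?thesis
      by (simp add: matrix_vector_mult_basis inner_axis' column_def diag_def)
  qed
  have "\<forall>k. \<exists>\<epsilon>>0. \<forall>\<xi> \<zeta>. (\<xi> - \<zeta>) \<bullet> (f k \<xi> - f k \<zeta> - \<alpha> *\<^sub>R (\<Gamma> *v (\<xi> - \<zeta>)))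
      \<le> - \<epsilon> * ((\<xi> - \<zeta>) \<bullet> (\<xi> - \<zeta>))"
    using assms(7) by (simp add: decreasing_condition_def)
  then obtain \<epsilon> where \<epsilon>: "\<And>k. \<epsilon> k > 0"
    and decr_k: "\<And>k \<xi> \<zeta>. (\<xi> - \<zeta>) \<bullet> (f k \<xi> - f k \<zeta> - \<alpha> *\<^sub>R (\<Gamma> *v (\<xi> - \<zeta>)))
      \<le> - \<epsilon> k * ((\<xi> - \<zeta>) \<bullet> (\<xi> - \<zeta>))"
    by metis
  \<comment> \<open>The rates of the clusters may differ; there are finitely many, so the smallest one serves all.\<close>
  define \<delta> where "\<delta> = Min (range \<epsilon>)"
  have "\<delta> > 0" using \<epsilon> by (simp add: \<delta>_def)
  have decr: "(\<xi> - \<zeta>) \<bullet> (f k \<xi> - f k \<zeta> - \<alpha> *\<^sub>R (\<Gamma> *v (\<xi> - \<zeta>)))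
      \<le> - \<delta> * ((\<xi> - \<zeta>) \<bullet> (\<xi> - \<zeta>))" for k \<xi> \<zeta>
  proof -
    have "\<delta> \<le> \<epsilon> k" by (simp add: \<delta>_def)
    then have "\<delta> * ((\<xi> - \<zeta>) \<bullet> (\<xi> - \<zeta>)) \<le> \<epsilon> k * ((\<xi> - \<zeta>) \<bullet> (\<xi> - \<zeta>))"
      by (intro mult_right_mono) auto
    then show ?thesis using decr_k[of \<xi> \<zeta> k] by simp
  qed
  show ?thesis
    unfolding cluster_synchronizes_def
  proof (intro allI impI ballI)
    fix x k i j
    assume sol: "coupled_solution C f ?G \<Gamma> x" and ij: "i \<in> C k" "j \<in> C k"
    define y where "y t = (\<chi> i. vertex_velocity C f ?G \<Gamma> (x t) i)" for t
    define e where "e t = deviation C d (x t)" for t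
    define V where "V t = (\<Sum>i\<in>UNIV. d $ i * (e t i \<bullet> e t i))" for t
    define V' where "V' t = 2 * (\<Sum>i\<in>UNIV. d $ i * (e t i \<bullet> y t $ i))" for t
    have deriv_x: "((\<lambda>s. x s $ i) has_vector_derivative y t $ i) (at t within {0..})" if "t \<ge> 0" for i t
    proof -
      have "i \<in> C (cluster_of C i)" by (simp add: clustering_mem_iff[OF cl])
      then show ?thesis
        using sol that by (simp add: coupled_solution_def y_def vertex_velocity_def)
    qed
    have deriv_V: "(V has_real_derivative V' t) (at t within {0..})" if "t \<ge> 0" for t
    proof -
      have e': "((\<lambda>s. e s i) has_vector_derivative deviation C d (y t) i) (at t within {0..})" for i
        unfolding e_def by (intro has_vector_derivative_deviation deriv_x that)
      have "((\<lambda>s. e s i \<bullet> e s i) has_real_derivative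
          2 * (e t i \<bullet> deviation C d (y t) i)) (at t within {0..})" for i
        using bounded_bilinear.has_vector_derivative[OF bounded_bilinear_inner e' e', of i i]
        by (simp add: has_real_derivative_iff_has_vector_derivative inner_commute)
      then have "(V has_real_derivative
          (\<Sum>i\<in>UNIV. d $ i * (2 * (e t i \<bullet> deviation C d (y t) i)))) (at t within {0..})"
        unfolding V_def by (intro DERIV_sum DERIV_cmult)
      \<comment> \<open>The velocity of the centre of mass is the same for all vertices of a cluster, so it drops out.\<close>
      moreover have "(\<Sum>i\<in>UNIV. d $ i * (2 * (e t i \<bullet> deviation C d (y t) i))) = V' t"
      proof -
        have "(\<Sum>i\<in>UNIV. d $ i * (e t i \<bullet> centroid d (C (cluster_of C i)) (y t))) = 0"
          unfolding e_def by (rule deviation_orthogonal[OF cl pos, where b = "\<lambda>k. centroid d (C k) (y t)"])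
        moreover have "(\<Sum>i\<in>UNIV. d $ i * (2 * (e t i \<bullet> deviation C d (y t) i)))
            = V' t - 2 * (\<Sum>i\<in>UNIV. d $ i * (e t i \<bullet> centroid d (C (cluster_of C i)) (y t)))"
          unfolding V'_def deviation_def sum_distrib_left sum_subtractf[symmetric]
          by (simp add: inner_diff_right algebra_simps)
        ultimately show ?thesis by simp
      qed
      ultimately show ?thesis by simp
    qed
    have "V' t \<le> - (2 * \<delta>) * V t" for t
      using deviation_dissipation[where G = ?G and f = f and x = "x t",
          OF cl pos coupling_matrix_block_row_sums[OF cl assms(6)] decr assms(8,9) nonpos]
      by (simp add: V'_def V_def e_def y_def)
    then have V_le: "V t \<le> V 0 * exp (- (2 * \<delta>) * t)" if "t \<ge> 0" for t
      using exponential_decay[of V V', OF deriv_V] that by blast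
    have "((\<lambda>t. exp (- (2 * \<delta>) * t)) \<longlongrightarrow> 0) at_top"
      using \<open>\<delta> > 0\<close> by (intro filterlim_compose[OF exp_at_bot]
          filterlim_tendsto_neg_mult_at_bot[OF tendsto_const _ filterlim_ident]) simp
    then have V_lim: "((\<lambda>t. V 0 * exp (- (2 * \<delta>) * t)) \<longlongrightarrow> 0) at_top"
      by (rule tendsto_mult_right_zero)
    have e_lim: "((\<lambda>t. e t i) \<longlongrightarrow> 0) at_top" for i
    proof -
      have "(norm (e t i))\<^sup>2 \<le> (1 / d $ i) * (V 0 * exp (- (2 * \<delta>) * t))" if "t \<ge> 0" for t
      proof -
        have "d $ i * (e t i \<bullet> e t i) \<le> V t"
          unfolding V_def
          by (rule member_le_sum) (auto intro: mult_nonneg_nonneg less_imp_le[OF pos])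
        then have "d $ i * (norm (e t i))\<^sup>2 \<le> V 0 * exp (- (2 * \<delta>) * t)"
          using V_le[OF that] by (simp add: power2_norm_eq_inner)
        then show ?thesis using pos[of i] by (simp add: field_simps)
      qed
      then have "\<forall>\<^sub>F t in at_top. (norm (e t i))\<^sup>2 \<le> (1 / d $ i) * (V 0 * exp (- (2 * \<delta>) * t))"
        by (rule eventually_at_top_linorderI)
      then have "((\<lambda>t. (norm (e t i))\<^sup>2) \<longlongrightarrow> 0) at_top"
        by (rule tendsto_sandwich[OF always_eventually _ tendsto_const
              tendsto_mult_right_zero[OF V_lim], rotated]) simp
      then have "((\<lambda>t. sqrt ((norm (e t i))\<^sup>2)) \<longlongrightarrow> sqrt 0) at_top"
        by (rule tendsto_real_sqrt)
      then show ?thesis by (simp add: tendsto_norm_zero_iff)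
    qed
    \<comment> \<open>Vertices of one cluster are compared with the same centre, which cancels.\<close>
    have "x t $ i - x t $ j = e t i - e t j" for t
      using ij by (simp add: e_def deviation_def clustering_mem_iff[OF cl])
    then show "((\<lambda>t. x t $ i - x t $ j) \<longlongrightarrow> 0) at_top"
      using tendsto_diff[OF e_lim[of i] e_lim[of j]] by simp
  qed
qed

end
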